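(* Let $n \in \mathbb{N}$, let $R \subseteq [n]\times[n]$ be a binary relation on $[n]=\{1,\ldots,n\}$, and let $C_k(i,j) \in \mathbb{Z}$ be integers for $i,j,k \in [n]$. Then the exponential system $\mathcal{E}(R,\{C_k(i,j)\})$ is partition regular if and only if the associated linear system $\mathcal{L}(R,\{C_k(i,j)\})$ is partition regular.
   Context: The exponential system $\mathcal{E}(R,\{C_k(i,j)\})$ is the system of equations \[ X_i^{\,Y_1^{C_1(i,j)} \cdots Y_n^{C_n(i,j)}} = X_j \quad \text{for all } (i,j) \in R, \] in the $2n$ variables $X_1,\ldots,X_n,Y_1,\ldots,Y_n$. It is called partition regular if for every finite colouring of $\mathbb{N}$ (a map from $\mathbb{N}$ to a finite set) there exist positive integers $x_1,\ldots,x_n,y_1,\ldots,y_n$, all different from $1$, all receiving the same colour, which satisfy the system. The associated linear system $\mathcal{L}(R,\{C_k(i,j)\})$ is defined as follows. Regard $R$ as a directed graph $D=([n],R)$. For every (not necessarily directed) cycle $C$ of $D$, fix an orientation of $C$, and for each edge $e$ of $C$ let $d(e)=0$ if $e$ is oriented the same way as $C$ and $d(e)=1$ otherwise. Then $\mathcal{L}$ is the system, with one equation for each such cycle $C$, \[ \sum_{e \in C} (-1)^{d(e)}\bigl(C_1(e)Y_1 + \cdots + C_n(e)Y_n\bigr) = 0, \] in the variables $Y_1,\ldots,Y_n$ (here $C_k(e)=C_k(i,j)$ for $e=(i,j)$). It is called partition regular if every finite colouring of $\mathbb{N}$ admits positive integers $y_1,\ldots,y_n$ of the same colour satisfying all these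 equations. *)

theory Defs
  imports Complex_Main
begin

text \<open>Throughout, the index set is \<open>{1..n}\<close>, the natural numbers being coloured are the
  positive integers, and \<open>C k i j\<close> stands for $C_k(i,j)$.\<close>

definition finite_colouring :: "(nat \<Rightarrow> nat) \<Rightarrow> bool" where
  "finite_colouring c \<longleftrightarrow> finite (c ` {0<..})"

text \<open>The exponents $C_k(i,j)$ may be negative, so the exponent of $x_i$ is a positive rational
  number in general; the equation is read in the reals.\<close>

definition solves_exp_system ::
  "nat \<Rightarrow> (nat \<times> nat) set \<Rightarrow> (nat \<Rightarrow> nat \<Rightarrow> nat \<Rightarrow> int) \<Rightarrow> (nat \<Rightarrow> nat) \<Rightarrow> (nat \<Rightarrow> nat) \<Rightarrow> bool" where
  "solves_exp_system n R C x y \<longleftrightarrow>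
    (\<forall>(i, j) \<in> R. real (x i) powr (\<Prod>k = 1..n. real (y k) powi C k i j) = real (x j))"

definition exp_system_partition_regular ::
  "nat \<Rightarrow> (nat \<times> nat) set \<Rightarrow> (nat \<Rightarrow> nat \<Rightarrow> nat \<Rightarrow> int) \<Rightarrow> bool" where
  "exp_system_partition_regular n R C \<longleftrightarrow>
    (\<forall>c. finite_colouring c \<longrightarrow>
      (\<exists>x y col.
        (\<forall>i\<in>{1..n}. x i > 0 \<and> x i \<noteq> 1 \<and> c (x i) = col \<and>
                    y i > 0 \<and> y i \<noteq> 1 \<and> c (y i) = col) \<and>
        solves_exp_system n R C x y))"

text \<open>A step \<open>(e, d)\<close> traverses the edge \<open>e\<close> forwards if \<open>d = 0\<close> and backwards if \<open>d = 1\<close>.\<close>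

type_synonym step = "(nat \<times> nat) \<times> nat"

definition step_start :: "step \<Rightarrow> nat" where
  "step_start s = (case s of ((i, j), d) \<Rightarrow> if d = 0 then i else j)"

definition step_end :: "step \<Rightarrow> nat" where
  "step_end s = (case s of ((i, j), d) \<Rightarrow> if d = 0 then j else i)"

text \<open>A not necessarily directed cycle of the digraph with edge set \<open>R\<close>, together with an
  orientation and a starting point: a closed walk with no repeated vertex and no repeated edge.
  A loop \<open>(i, i)\<close> is a cycle of length 1, and a pair of opposite edges \<open>(i, j)\<close>, \<open>(j, i)\<close> with
  \<open>i \<noteq> j\<close> is a cycle of length 2; distinctness of the edges excludes going back and forth along
  a single edge.\<close>

definition oriented_cycle :: "(nat \<times> nat) set \<Rightarrow> step list \<Rightarrow> bool" where
  "oriented_cycle R S \<longleftrightarrow>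
    S \<noteq> [] \<and>
    (\<forall>(e, d) \<in> set S. e \<in> R \<and> d \<in> {0, 1}) \<and>
    distinct (map fst S) \<and>
    distinct (map step_start S) \<and>
    (\<forall>t < length S. step_end (S ! t) = step_start (S ! (Suc t mod length S)))"

definition cycle_form ::
  "nat \<Rightarrow> (nat \<Rightarrow> nat \<Rightarrow> nat \<Rightarrow> int) \<Rightarrow> (nat \<Rightarrow> nat) \<Rightarrow> step list \<Rightarrow> int" where
  "cycle_form n C y S =
    (\<Sum>((i, j), d) \<leftarrow> S. (-1) ^ d * (\<Sum>k = 1..n. C k i j * int (y k)))"

text \<open>Instead of fixing one orientation of each cycle, the equation is imposed for both. This is
  the same system: changing the starting point rotates the list, which does not change the sum,
  and reversing the orientation negates it.\<close>

definition solves_lin_system ::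
  "nat \<Rightarrow> (nat \<times> nat) set \<Rightarrow> (nat \<Rightarrow> nat \<Rightarrow> nat \<Rightarrow> int) \<Rightarrow> (nat \<Rightarrow> nat) \<Rightarrow> bool" where
  "solves_lin_system n R C y \<longleftrightarrow> (\<forall>S. oriented_cycle R S \<longrightarrow> cycle_form n C y S = 0)"

lemma cycle_form_rotate: "cycle_form n C y (rotate m S) = cycle_form n C y S"
proof -
  have "sum_list (map f (drop t S) @ map f (take t S)) = sum_list (map f S)"
    for f :: "step \<Rightarrow> int" and t
    by (metis add.commute append_take_drop_id map_append sum_list_append)
  then show ?thesis
    by (simp add: cycle_form_def rotate_drop_take)
qed

lemma cycle_form_reverse:
  assumes "oriented_cycle R S"
  shows "cycle_form n C y (rev (map (\<lambda>(e, d). (e, 1 - d)) S)) = - cycle_form n C y S"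
proof -
  have "\<forall>(e, d) \<in> set S. d \<in> {0, 1}"
    using assms by (auto simp: oriented_cycle_def)
  then show ?thesis
    unfolding cycle_form_def rev_map [symmetric] sum_list_rev
    by (induction S) auto
qed

definition lin_system_partition_regular ::
  "nat \<Rightarrow> (nat \<times> nat) set \<Rightarrow> (nat \<Rightarrow> nat \<Rightarrow> nat \<Rightarrow> int) \<Rightarrow> bool" where
  "lin_system_partition_regular n R C \<longleftrightarrow>
    (\<forall>c. finite_colouring c \<longrightarrow>
      (\<exists>y col.
        (\<forall>k\<in>{1..n}. y k > 0 \<and> c (y k) = col) \<and>
        solves_lin_system n R C y))"

end

theory Submission
  imports Defs "HOL-Library.Infinite_Set" "HOL-Computational_Algebra.Primes"
begin

text \<open>If \<open>(x, y)\<close> solves the exponential system, taking logarithms twice and summing around a cycle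
  gives a multiplicative relation \<open>\<Prod>y\<^sub>k^D\<^sub>k = 1\<close>, so the numbers \<open>\<Omega>(y\<^sub>k)\<close> of prime factors, with
  multiplicity, solve the linear system.

  Conversely, a solution \<open>a\<close> of the linear system has a potential \<open>b\<close> on the graph, with
  \<open>b\<^sub>j - b\<^sub>i = \<Sum>\<^sub>k C\<^sub>k(i,j) a\<^sub>k\<close> on each edge, and \<open>x\<^sub>i = 2^(p 2^(d b\<^sub>i))\<close>, \<open>y\<^sub>k = 2^(d a\<^sub>k)\<close> solve the
  exponential system for all \<open>d\<close> and \<open>p\<close>. For each \<open>N\<close> one finds \<open>d = d\<^sub>N\<close> such that the colour of
  every \<open>m d\<close> with \<open>m \<le> N\<close> also occurs, for some \<open>p\<close>, on all \<open>p 2^(d f)\<close> with \<open>f \<le> N\<close>. The solution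
  \<open>a\<close> is then chosen monochromatic for a pointwise limit of the colourings \<open>m \<mapsto> c(m d\<^sub>N)\<close>.\<close>

section \<open>Van der Waerden's theorem\<close>

definition vdw_bound :: "nat \<Rightarrow> 'a set \<Rightarrow> nat \<Rightarrow> bool" where
  "vdw_bound l S W \<longleftrightarrow>
    (\<forall>f :: nat \<Rightarrow> 'a. range f \<subseteq> S \<longrightarrow>
      (\<exists>u q. 0 < q \<and> q \<le> W \<and> u + l * q \<le> W \<and> (\<forall>i<l. f (u + i * q) = f u)))"

text \<open>This allows colours that are themselves lists of colours, as used for windows and blocks
  below.\<close>

lemma vdw_bound_transfer:
  fixes S :: "'a set"
  assumes "\<And>r :: nat. \<exists>W. vdw_bound l {..<r} W" and "finite S"
  shows "\<exists>W. vdw_bound l S W"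
proof -
  obtain h :: "'a \<Rightarrow> nat" where h: "bij_betw h S {0..<card S}"
    using ex_bij_betw_finite_nat [OF assms(2)] by blast
  obtain W where W: "vdw_bound l {..<card S} W"
    using assms(1) by blast
  have "vdw_bound l S W"
    unfolding vdw_bound_def
  proof (intro allI impI)
    fix f :: "nat \<Rightarrow> 'a"
    assume f: "range f \<subseteq> S"
    have "range (h \<circ> f) \<subseteq> {..<card S}"
      using f bij_betwE [OF h] by fastforce
    then obtain u q where uq: "0 < q" "q \<le> W" "u + l * q \<le> W"
      and eq: "\<forall>i<l. (h \<circ> f) (u + i * q) = (h \<circ> f) u"
      using W unfolding vdw_bound_def by blast
    have "\<forall>i<l. f (u + i * q) = f u"
      using eq f inj_on_eq_iff [OF bij_betw_imp_inj_on [OF h]] by (simp add: image_subset_iff)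
    with uq show "\<exists>u q. 0 < q \<and> q \<le> W \<and> u + l * q \<le> W \<and> (\<forall>i<l. f (u + i * q) = f u)"
      by blast
  qed
  then show ?thesis ..
qed

text \<open>All the progressions, one per colour in \<open>P\<close>, would have \<open>z\<close> as
  their next term; if \<open>z\<close> has a colour in \<open>P\<close>, one of them
  extends.\<close>

definition focused :: "nat \<Rightarrow> (nat \<Rightarrow> nat) \<Rightarrow> nat set \<Rightarrow> nat \<Rightarrow> bool" where
  "focused l f P z \<longleftrightarrow> (\<forall>p\<in>P. \<exists>u q. 0 < q \<and> u + l * q = z \<and> (\<forall>i<l. f (u + i * q) = p))"

text \<open>There are \<open>l + 1\<close> terms, one more than in \<open>vdw_bound l\<close>, as
  the induction on \<open>l\<close> requires.\<close>

definition mono_AP :: "nat \<Rightarrow> (nat \<Rightarrow> nat) \<Rightarrow> nat \<Rightarrow> bool" where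
  "mono_AP l f W \<longleftrightarrow>
    (\<exists>u q. 0 < q \<and> q \<le> W \<and> u + l * q \<le> W \<and> (\<forall>i\<le>l. f (u + i * q) = f u))"

lemma mono_AP_of_focused:
  assumes "focused l f P z" and "f z \<in> P" and "z \<le> W" and "l > 0"
  shows "mono_AP l f W"
proof -
  obtain u q where uq: "0 < q" "u + l * q = z" "\<forall>i<l. f (u + i * q) = f z"
    using bspec [OF assms(1) [unfolded focused_def] assms(2)] by auto
  have "f (u + 0 * q) = f z"
    using uq(3) assms(4) by blast
  then have "f u = f z"
    by simp
  moreover have "f (u + i * q) = f z" if "i \<le> l" for i
    using uq that by (cases "i = l") auto
  ultimately have "\<forall>i\<le>l. f (u + i * q) = f u"
    by simp
  moreover have "1 * q \<le> l * q"
    using assms(4) by (intro mult_le_mono1) simp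
  then have "q \<le> W" "u + l * q \<le> W"
    using uq(2) assms(3) by linarith+
  ultimately show ?thesis
    unfolding mono_AP_def using uq(1) by blast
qed

lemma mono_AP_shift:
  assumes "mono_AP l (\<lambda>x. f (e + x)) W"
  shows "mono_AP l f (e + W)"
proof -
  obtain u q where "0 < q" "q \<le> W" "u + l * q \<le> W" "\<forall>i\<le>l. f (e + (u + i * q)) = f (e + u)"
    using assms unfolding mono_AP_def by blast
  then show ?thesis
    unfolding mono_AP_def by (intro exI [of _ "e + u"] exI [of _ q]) (auto simp: add.assoc)
qed

lemma mono_AP_mono: "mono_AP l f W \<Longrightarrow> W \<le> W' \<Longrightarrow> mono_AP l f W'"
  unfolding mono_AP_def by (meson order_trans)

text \<open>Colour focusing: if the windows \<open>[e + iq, e + iq + W]\<close> for \<open>i < l\<close> are coloured alike, then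
  a focus \<open>z\<close> in the first of them moves to \<open>z + lq\<close>, every progression of step \<open>q'\<close> is replaced
  by the one of step \<open>q' + q\<close> with the same start, and the translates of \<open>z\<close> form a new
  progression in the colour of \<open>z\<close>.\<close>

lemma colour_focusing:
  assumes vdw: "\<And>r :: nat. \<exists>W. vdw_bound l {..<r} W" and l: "l > 0"
  shows "\<exists>W. \<forall>f. range f \<subseteq> {..<r} \<longrightarrow>
    mono_AP l f W \<or> (\<exists>z\<le>W. \<exists>P. P \<subseteq> {..<r} \<and> card P = s \<and> focused l f P z)"
proof (induction s)
  case 0
  show ?case
    by (rule exI [of _ 0]) (auto simp: focused_def intro!: exI [of _ "{}"])
next
  case (Suc s)
  then obtain W where W: "\<And>f. range f \<subseteq> {..<r} \<Longrightarrow>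
    mono_AP l f W \<or> (\<exists>z\<le>W. \<exists>P. P \<subseteq> {..<r} \<and> card P = s \<and> focused l f P z)"
    by blast
  \<comment> \<open>A window of \<open>W + 1\<close> consecutive values counts as a single colour of
    its left end.\<close>
  define S where "S = {xs. set xs \<subseteq> {..<r} \<and> length xs = Suc W}"
  have "finite S"
    unfolding S_def by (rule finite_lists_length_eq) simp
  then obtain V where V: "vdw_bound l S V"
    using vdw_bound_transfer [OF vdw] by blast
  show ?case
  proof (intro exI [of _ "V + W"] allI impI)
    fix f :: "nat \<Rightarrow> nat"
    assume f: "range f \<subseteq> {..<r}"
    define g where "g = (\<lambda>x. map (\<lambda>j. f (x + j)) [0..<Suc W])"
    have "range g \<subseteq> S"
      using f unfolding g_def S_def by (auto simp: image_subset_iff)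
    then obtain e q where q: "0 < q" "q \<le> V" "e + l * q \<le> V"
      and g: "\<forall>i<l. g (e + i * q) = g e"
      using V unfolding vdw_bound_def by blast
    have win: "f (e + i * q + j) = f (e + j)" if "i < l" "j \<le> W" for i j
    proof -
      have "g (e + i * q) ! j = g e ! j"
        using g that by simp
      then show ?thesis
        using that unfolding g_def by (simp add: nth_append del: upt_Suc)
    qed
    show "mono_AP l f (V + W) \<or>
      (\<exists>z\<le>V + W. \<exists>P. P \<subseteq> {..<r} \<and> card P = Suc s \<and> focused l f P z)"
    proof (cases "mono_AP l f (V + W)")
      case False
      have range': "range (\<lambda>x. f (e + x)) \<subseteq> {..<r}"
        using f by auto
      have "\<not> mono_AP l (\<lambda>x. f (e + x)) W"
        using False mono_AP_shift mono_AP_mono q(3) by (metis add_le_mono1 le_add1 order_trans)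
      then obtain z P where z: "z \<le> W" and P: "P \<subseteq> {..<r}" "card P = s"
        and foc: "focused l (\<lambda>x. f (e + x)) P z"
        using W [OF range'] by blast
      \<comment> \<open>Otherwise the focus would complete a monochromatic progression; so each
        stage gains a new colour.\<close>
      have notin: "f (e + z) \<notin> P"
        using mono_AP_of_focused [OF foc _ z l] \<open>\<not> mono_AP l (\<lambda>x. f (e + x)) W\<close> by blast
      have "focused l f (insert (f (e + z)) P) (e + z + l * q)"
        unfolding focused_def
      proof
        fix p
        assume "p \<in> insert (f (e + z)) P"
        then consider "p = f (e + z)" | "p \<in> P"
          by blast
        then show "\<exists>u q'. 0 < q' \<and> u + l * q' = e + z + l * q \<and> (\<forall>i<l. f (u + i * q') = p)"
        proof cases
          case 1
          have "\<forall>i<l. f (e + z + i * q) = p"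
            using win z 1 by (metis add.assoc add.commute)
          with q(1) show ?thesis
            by blast
        next
          case 2
          then obtain u q' where u: "0 < q'" "u + l * q' = z" "\<forall>i<l. f (e + (u + i * q')) = p"
            using foc unfolding focused_def by blast
          have "f (e + u + i * (q' + q)) = p" if "i < l" for i
          proof -
            have "i * q' \<le> l * q'"
              using that by simp
            then have "u + i * q' \<le> W"
              using u(2) z by linarith
            then have "f (e + i * q + (u + i * q')) = p"
              using win u(3) that by simp
            then show ?thesis
              by (simp add: algebra_simps)
          qed
          moreover have "e + u + l * (q' + q) = e + z + l * q"
            using u(2) by (simp add: algebra_simps)
          ultimately show ?thesis
            using u(1) by (intro exI [of _ "e + u"] exI [of _ "q' + q"]) simp
        qed
      qed
      moreover have "card (insert (f (e + z)) P) = Suc s"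
        using notin P finite_subset by fastforce
      moreover have "insert (f (e + z)) P \<subseteq> {..<r}"
        using f P by auto
      moreover have "e + z + l * q \<le> V + W"
        using q z by linarith
      ultimately show ?thesis
        by blast
    qed blast
  qed
qed

text \<open>Focusing \<open>Suc r\<close> distinct colours is impossible with only \<open>r\<close>
  of them, so colour focusing must yield the longer progression.\<close>

lemma vdw_nat: "\<exists>W. vdw_bound l {..<r :: nat} W"
proof (induction l arbitrary: r)
  case 0
  show ?case
    unfolding vdw_bound_def by (intro exI [of _ 1]) auto
next
  case (Suc l)
  show ?case
  proof (cases "l = 0")
    case True
    then show ?thesis
      unfolding vdw_bound_def by (intro exI [of _ 1] allI impI exI [of _ 0]) auto
  next
    case False
    then obtain W where W: "\<And>f. range f \<subseteq> {..<r} \<Longrightarrow>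
      mono_AP l f W \<or> (\<exists>z\<le>W. \<exists>P. P \<subseteq> {..<r} \<and> card P = Suc r \<and> focused l f P z)"
      using colour_focusing [OF Suc.IH, of r "Suc r"] by blast
    have "card P \<noteq> Suc r" if "P \<subseteq> {..<r}" for P
      using card_mono [OF finite_lessThan that] by simp
    then have "mono_AP l f W" if "range f \<subseteq> {..<r}" for f
      using W [OF that] by blast
    \<comment> \<open>The doubling makes room for \<open>u + Suc l * q\<close>, which lies
      \<open>q \<le> W\<close> beyond \<open>u + l * q \<le> W\<close>.\<close>
    then have "vdw_bound (Suc l) {..<r} (2 * W)"
      unfolding vdw_bound_def mono_AP_def
    proof (intro allI impI)
      fix f :: "nat \<Rightarrow> nat"
      assume *: "\<And>f. range f \<subseteq> {..<r} \<Longrightarrow> \<exists>u q. 0 < q \<and> q \<le> W \<and> u + l * q \<le> W \<and>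
          (\<forall>i\<le>l. f (u + i * q) = f u)" and "range f \<subseteq> {..<r}"
      then obtain u q where "0 < q" "q \<le> W" "u + l * q \<le> W" "\<forall>i\<le>l. f (u + i * q) = f u"
        by blast
      then show "\<exists>u q. 0 < q \<and> q \<le> 2 * W \<and> u + Suc l * q \<le> 2 * W \<and>
          (\<forall>i<Suc l. f (u + i * q) = f u)"
        by (intro exI [of _ u] exI [of _ q]) auto
    qed
    then show ?thesis ..
  qed
qed

theorem van_der_Waerden: "finite S \<Longrightarrow> \<exists>W. vdw_bound l S W"
  by (rule vdw_bound_transfer [OF vdw_nat])

section \<open>Monochromatic multiples and geometric progressions\<close>

lemma finite_minimal_subset:
  assumes "finite A" and "P A"
  obtains G where "G \<subseteq> A" "P G" "\<And>a. a \<in> G \<Longrightarrow> \<not> P (G - {a})"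
proof -
  have "\<exists>G\<subseteq>A. P G \<and> (\<forall>a\<in>G. \<not> P (G - {a}))"
    using assms
  proof (induction A rule: finite_psubset_induct)
    case (psubset A)
    show ?case
    proof (cases "\<exists>a\<in>A. P (A - {a})")
      case True
      then obtain a where a: "a \<in> A" "P (A - {a})"
        by blast
      then have "A - {a} \<subset> A"
        by blast
      from psubset.IH [OF this a(2)] show ?thesis
        by blast
    qed (use psubset.prems in blast)
  qed
  then show thesis
    using that by blast
qed

text \<open>Let \<open>G\<close> be a minimal set of colours such that some \<open>2\<^sup>t {1..K}\<close> is coloured by \<open>G\<close> alone,
  for every \<open>K\<close>. By minimality there is a \<open>K\<close> such that every \<open>2\<^sup>t {1..K}\<close> coloured by \<open>G\<close> meets
  all the colours of \<open>G\<close>. Van der Waerden's theorem applied to \<open>t \<mapsto>\<close> the colouring of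
  \<open>2\<^sup>t {1..K}\<close> yields progressions of a common difference in all colours of \<open>G\<close> at once; this
  difference can be taken of the form \<open>q 2\<^sup>t\<^sup>0\<close> with \<open>q\<close> bounded, so that its small multiples
  are coloured by \<open>G\<close>.\<close>

lemma monochromatic_multiples:
  assumes "finite_colouring c"
  shows "\<exists>d>0. \<forall>m\<in>{1..N}. \<exists>p>0. \<forall>f\<le>N. c (p * 2 ^ (d * f)) = c (m * d)"
proof -
  define thick where "thick = (\<lambda>G. \<forall>K. \<exists>t. \<forall>m\<in>{1..K}. c (m * 2 ^ t) \<in> G)"
  have fin: "finite (c ` {0<..})"
    using assms by (simp add: finite_colouring_def)
  moreover have "thick (c ` {0<..})"
    by (auto simp: thick_def)
  ultimately obtain G where G: "G \<subseteq> c ` {0<..}" "thick G"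
    and min: "\<And>a. a \<in> G \<Longrightarrow> \<not> thick (G - {a})"
    by (rule finite_minimal_subset) blast
  have "finite G"
    using G(1) fin finite_subset by blast
  have "\<forall>a\<in>G. \<exists>K. \<forall>t. \<exists>m\<in>{1..K}. c (m * 2 ^ t) \<notin> G - {a}"
    using min unfolding thick_def by blast
  then obtain k where k: "\<And>a t. a \<in> G \<Longrightarrow> \<exists>m\<in>{1..k a}. c (m * 2 ^ t) \<notin> G - {a}"
    by metis
  define K where "K = Max (insert 0 (k ` G))"
  have K: "\<exists>m\<in>{1..K}. c (m * 2 ^ t) \<notin> G - {a}" if "a \<in> G" for a t
  proof -
    have "k a \<le> K"
      unfolding K_def using that \<open>finite G\<close> by simp
    then show ?thesis
      using k [OF that, of t] by (meson atLeastAtMost_iff order_trans)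
  qed
  define S where "S = {xs. set xs \<subseteq> c ` {0<..} \<and> length xs = K}"
  have "finite S"
    unfolding S_def by (rule finite_lists_length_eq) (rule fin)
  then obtain W where W: "vdw_bound (Suc N) S W"
    using van_der_Waerden by blast
  \<comment> \<open>The difference will be \<open>q * 2 ^ t0\<close> with \<open>q \<le> W\<close>;
    its multiples by \<open>m \<le> N\<close> lie in \<open>2 ^ t0\<close> times
    \<open>{1..N * W}\<close>.\<close>
  obtain t0 where t0: "\<And>m. m \<in> {1..N * W} \<Longrightarrow> c (m * 2 ^ t0) \<in> G"
    using G(2) unfolding thick_def by blast
  define T :: nat where "T = 2 ^ t0"
  \<comment> \<open>This block contains \<open>{1..K}\<close> scaled by
    \<open>2 ^ (t + T * j)\<close> for every \<open>j \<le> W\<close>.\<close>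
  obtain t where t: "\<And>m. m \<in> {1..K * 2 ^ (T * W)} \<Longrightarrow> c (m * 2 ^ t) \<in> G"
    using G(2) unfolding thick_def by blast
  \<comment> \<open>Only every \<open>T\<close>-th exponent is sampled, so that step
    \<open>q\<close> in \<open>j\<close> is step \<open>q * T\<close> in the exponent, which is also
    the required \<open>d\<close>.\<close>
  define g where "g = (\<lambda>j. map (\<lambda>m. c (m * 2 ^ (t + T * j))) [1..<Suc K])"
  have "range g \<subseteq> S"
    unfolding g_def S_def by auto
  then obtain u q where q: "0 < q" "q \<le> W" "u + Suc N * q \<le> W"
    and g: "\<And>i. i < Suc N \<Longrightarrow> g (u + i * q) = g u"
    using W unfolding vdw_bound_def by blast
  have g_eq: "c (m * 2 ^ (t + T * (u + i * q))) = c (m * 2 ^ (t + T * u))"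
    if "i \<le> N" "m \<in> {1..K}" for i m
    using g [of i] that unfolding g_def by (simp del: upt_Suc)
  show ?thesis
  proof (rule exI [of _ "q * T"], intro conjI ballI)
    show "0 < q * T"
      using q(1) by (simp add: T_def)
  next
    fix m
    assume m: "m \<in> {1..N}"
    then have "m * q \<in> {1..N * W}"
      using q by (simp add: mult_le_mono)
    then have a: "c (m * (q * T)) \<in> G"
      using t0 unfolding T_def by (metis mult.assoc)
    \<comment> \<open>By the choice of \<open>K\<close>, some entry avoids every other colour of
      \<open>G\<close>; being coloured from \<open>G\<close>, it has the colour of
      \<open>m * (q * T)\<close>.\<close>
    then obtain m' where m': "m' \<in> {1..K}" "c (m' * 2 ^ (t + T * u)) \<notin> G - {c (m * (q * T))}"
      using K by blast
    have "(2 :: nat) ^ (T * u) \<le> 2 ^ (T * W)"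
      using q by (intro power_increasing) auto
    then have "m' * 2 ^ (T * u) \<in> {1..K * 2 ^ (T * W)}"
      using m'(1) by (simp add: mult_le_mono)
    then have "c (m' * 2 ^ (t + T * u)) \<in> G"
      using t by (metis mult.assoc add.commute power_add)
    with m' have colour: "c (m' * 2 ^ (t + T * u)) = c (m * (q * T))"
      by blast
    show "\<exists>p>0. \<forall>f\<le>N. c (p * 2 ^ (q * T * f)) = c (m * (q * T))"
    proof (intro exI [of _ "m' * 2 ^ (t + T * u)"] conjI allI impI)
      fix f
      assume "f \<le> N"
      have "t + T * u + q * T * f = t + T * (u + f * q)"
        by (simp add: algebra_simps)
      then have "m' * 2 ^ (t + T * u) * 2 ^ (q * T * f) = m' * 2 ^ (t + T * (u + f * q))"
        by (metis mult.assoc power_add)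
      then show "c (m' * 2 ^ (t + T * u) * 2 ^ (q * T * f)) = c (m * (q * T))"
        using g_eq [OF \<open>f \<le> N\<close> m'(1)] colour by (simp only:)
    qed (use m'(1) in simp)
  qed
qed

text \<open>Compactness by nested infinite sets: on \<open>X (Suc n)\<close> the value at
  \<open>n\<close> is constant, so one large \<open>N\<close> in \<open>X (Suc K)\<close> serves all
  \<open>m \<le> K\<close>.\<close>

lemma limit_colouring:
  fixes f :: "nat \<Rightarrow> nat \<Rightarrow> 'a"
  assumes "finite S" and "\<And>N m. f N m \<in> S"
  obtains g where "\<And>m. g m \<in> S" and "\<And>K. \<exists>N\<ge>K. \<forall>m\<le>K. f N m = g m"
proof -
  have "\<exists>X :: nat \<Rightarrow> nat set. \<forall>n. infinite (X n) \<and>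
    (X (Suc n) \<subseteq> X n \<and> (\<exists>a. \<forall>N\<in>X (Suc n). f N n = a))"
  proof (rule dependent_nat_choice)
    fix Y :: "nat set" and n
    assume "infinite Y"
    moreover have "finite ((\<lambda>N. f N n) ` Y)"
      by (rule finite_subset [OF _ assms(1)]) (use assms(2) in auto)
    ultimately obtain N0 where "infinite {N \<in> Y. f N n = f N0 n}"
      using pigeonhole_infinite by blast
    then show "\<exists>Z. infinite Z \<and> Z \<subseteq> Y \<and> (\<exists>a. \<forall>N\<in>Z. f N n = a)"
      by (intro exI [of _ "{N \<in> Y. f N n = f N0 n}"]) auto
  qed (use infinite_UNIV_nat in blast)
  then obtain X :: "nat \<Rightarrow> nat set" where inf: "\<And>n. infinite (X n)"
    and dec: "\<And>n. X (Suc n) \<subseteq> X n" and ex: "\<And>n. \<exists>a. \<forall>N\<in>X (Suc n). f N n = a"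
    by blast
  obtain g where g: "\<And>n N. N \<in> X (Suc n) \<Longrightarrow> f N n = g n"
    using ex by metis
  show thesis
  proof
    fix m
    obtain N where "N \<in> X (Suc m)"
      using infinite_imp_nonempty [OF inf] by blast
    then show "g m \<in> S"
      using g assms(2) by metis
  next
    fix K
    obtain N where N: "N \<ge> K" "N \<in> X (Suc K)"
      using inf infinite_nat_iff_unbounded_le by blast
    have "N \<in> X (Suc m)" if "m \<le> K" for m
      using lift_Suc_antimono_le [of X, OF dec, of "Suc m" "Suc K"] N that by blast
    with N(1) g show "\<exists>N\<ge>K. \<forall>m\<le>K. f N m = g m"
      by blast
  qed
qed

section \<open>Potentials\<close>

text \<open>Paths in the underlying undirected graph; since each start also avoids the final vertex
  \<open>v\<close>, no vertex repeats.\<close>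

inductive simple_path :: "(nat \<times> nat) set \<Rightarrow> nat \<Rightarrow> step list \<Rightarrow> nat \<Rightarrow> bool" for R where
  Nil: "simple_path R u [] u"
| Cons: "fst s \<in> R \<Longrightarrow> snd s \<in> {0, 1} \<Longrightarrow> simple_path R (step_end s) S v \<Longrightarrow>
    step_start s \<notin> insert v (step_start ` set S) \<Longrightarrow> simple_path R (step_start s) (s # S) v"

lemma simple_path_steps:
  "simple_path R u S v \<Longrightarrow> (e, d) \<in> set S \<Longrightarrow> e \<in> R \<and> d \<in> {0, 1}"
  by (induction rule: simple_path.induct) auto

lemma simple_path_end:
  "simple_path R u S v \<Longrightarrow> v \<notin> step_start ` set S"
  by (induction rule: simple_path.induct) auto

lemma simple_path_distinct_starts:
  "simple_path R u S v \<Longrightarrow> distinct (map step_start S)"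
  by (induction rule: simple_path.induct) auto

lemma simple_path_start: "simple_path R u S v \<Longrightarrow> u \<in> insert v (step_start ` set S)"
  by (induction rule: simple_path.induct) auto

lemma simple_path_ends:
  "simple_path R u S v \<Longrightarrow> step_end ` set S \<subseteq> insert v (step_start ` set S)"
  by (induction rule: simple_path.induct) (auto dest: simple_path_start)

lemma step_start_eq: "fst s = fst s' \<Longrightarrow> step_start s \<in> {step_start s', step_end s'}"
  by (cases s; cases s') (auto simp: step_start_def step_end_def split: prod.splits)

text \<open>A later step along the edge of \<open>s\<close> would have \<open>step_start s\<close>
  as an endpoint, but the rest of the path avoids that vertex.\<close>

lemma simple_path_distinct_edges:
  "simple_path R u S v \<Longrightarrow> distinct (map fst S)"
proof (induction rule: simple_path.induct)
  case (Cons s S v)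
  have "fst s \<noteq> fst s'" if "s' \<in> set S" for s'
    using step_start_eq [of s s'] simple_path_ends [OF Cons.hyps(3)] Cons.hyps(4) that by blast
  with Cons show ?case
    by auto
qed simp

text \<open>Appending \<open>v\<close> to the starts gives the full vertex sequence, so the last
  step is no special case.\<close>

lemma simple_path_chain:
  "simple_path R u S v \<Longrightarrow> (map step_start S @ [v]) ! 0 = u \<and>
    (\<forall>t<length S. step_end (S ! t) = (map step_start S @ [v]) ! Suc t)"
proof (induction rule: simple_path.induct)
  case (Cons s S v)
  then show ?case
    by (auto simp: less_Suc_eq_0_disj)
qed simp

lemma simple_path_suffix:
  "simple_path R u S v \<Longrightarrow> w \<in> insert v (step_start ` set S) \<Longrightarrow> \<exists>S'. simple_path R w S' v"
proof (induction rule: simple_path.induct)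
  case (Nil u)
  then show ?case
    by (auto intro: simple_path.Nil)
next
  case (Cons s S v)
  show ?case
  proof (cases "w = step_start s")
    case True
    then show ?thesis
      using simple_path.Cons [OF Cons.hyps] by blast
  qed (use Cons in auto)
qed

text \<open>Edges are prepended one at a time; if the new vertex is already on the path, the suffix
  from it replaces the path.\<close>

lemma simple_path_exists:
  assumes "(u, v) \<in> (R \<union> R\<inverse>)\<^sup>*"
  shows "\<exists>S. simple_path R u S v"
  using assms
proof (induction rule: converse_rtrancl_induct)
  case base
  show ?case
    using simple_path.Nil by blast
next
  case (step u w)
  then obtain S where S: "simple_path R w S v"
    by blast
  obtain s where s: "fst s \<in> R" "snd s \<in> {0, 1}" "step_start s = u" "step_end s = w"
  proof (cases "(u, w) \<in> R")
    case True
    then show thesis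
      using that [of "((u, w), 0)"] by (simp add: step_start_def step_end_def)
  next
    case False
    then show thesis
      using step(1) that [of "((w, u), 1)"] by (simp add: step_start_def step_end_def)
  qed
  show ?case
  proof (cases "u \<in> insert v (step_start ` set S)")
    case True
    then show ?thesis
      using simple_path_suffix [OF S] by blast
  next
    case False
    then show ?thesis
      using simple_path.Cons [of s R S v] s S by auto
  qed
qed

lemma simple_path_closes:
  assumes "simple_path R j S i" and "(i, j) \<notin> R"
  shows "oriented_cycle (insert (i, j) R) (((i, j), 0) # S)"
proof -
  note chain = simple_path_chain [OF assms(1)]
  \<comment> \<open>At \<open>t = length S\<close> the index wraps to \<open>0\<close>, the new
    edge, which starts at \<open>i\<close>.\<close>
  have nth: "(map step_start S @ [i]) ! t = step_start ((((i, j), 0) # S) ! (Suc t mod Suc (length S)))"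
    if "t \<le> length S" for t
    using that by (cases "t = length S") (auto simp: nth_append step_start_def)
  have "step_end ((((i, j), 0) # S) ! t) =
      step_start ((((i, j), 0) # S) ! (Suc t mod Suc (length S)))" if "t < Suc (length S)" for t
  proof (cases t)
    case 0
    then show ?thesis
      using chain nth [of 0] by (simp add: step_end_def)
  next
    case (Suc t')
    then show ?thesis
      using chain nth [of "Suc t'"] that by simp
  qed
  then show ?thesis
    using simple_path_steps [OF assms(1)] simple_path_end [OF assms(1)] assms(2)
      simple_path_distinct_starts [OF assms(1)] simple_path_distinct_edges [OF assms(1)]
    by (auto simp: oriented_cycle_def step_start_def)
qed

definition step_weight :: "(nat \<times> nat \<Rightarrow> int) \<Rightarrow> step \<Rightarrow> int" where
  "step_weight w = (\<lambda>(e, d). (-1) ^ d * w e)"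

lemma simple_path_weight:
  assumes "simple_path R u S v" and "\<And>i j. (i, j) \<in> R \<Longrightarrow> b j - b i = w (i, j)"
  shows "(\<Sum>s\<leftarrow>S. step_weight w s) = b v - b u"
  using assms(1)
proof (induction rule: simple_path.induct)
  case (Cons s S v)
  have "step_weight w s = b (step_end s) - b (step_start s)"
    using Cons.hyps(1,2) assms(2)
    by (cases s) (auto simp: step_weight_def step_start_def step_end_def simp flip: assms(2))
  with Cons.IH show ?case
    by simp
qed simp

text \<open>Edges are added one at a time. An edge inside a component closes a cycle, whose zero sum
  is the desired equation; an edge between components is handled by shifting one of them.\<close>

lemma potential_exists:
  assumes "finite R" and "\<And>S. oriented_cycle R S \<Longrightarrow> (\<Sum>s\<leftarrow>S. step_weight w s) = 0"
  shows "\<exists>b :: nat \<Rightarrow> int. \<forall>(i, j)\<in>R. b j - b i = w (i, j)"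
  using assms
proof (induction R rule: finite_induct)
  case (insert e R)
  obtain i j where e: "e = (i, j)"
    by (cases e)
  have "oriented_cycle (insert e R) S" if "oriented_cycle R S" for S
    using that by (fastforce simp: oriented_cycle_def)
  then obtain b where b: "\<And>k l. (k, l) \<in> R \<Longrightarrow> b l - b k = w (k, l)"
    using insert by blast
  show ?case
  proof (cases "(j, i) \<in> (R \<union> R\<inverse>)\<^sup>*")
    case True
    then obtain S where S: "simple_path R j S i"
      using simple_path_exists by blast
    then have "(\<Sum>s\<leftarrow>((i, j), 0) # S. step_weight w s) = 0"
      using simple_path_closes insert.hyps(2) insert.prems e by blast
    then have "b j - b i = w (i, j)"
      using simple_path_weight [OF S, of b w] b by (simp add: step_weight_def)
    then show ?thesis
      using b e by blast
  next
    case False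
    \<comment> \<open>The component of \<open>j\<close> is shifted by the error at the new edge; an
      old edge has both ends shifted or neither.\<close>
    define b' where "b' = (\<lambda>v. if (j, v) \<in> (R \<union> R\<inverse>)\<^sup>* then b v + (b i + w (i, j) - b j) else b v)"
    have "(j, k) \<in> (R \<union> R\<inverse>)\<^sup>* \<longleftrightarrow> (j, l) \<in> (R \<union> R\<inverse>)\<^sup>*" if "(k, l) \<in> R" for k l
      using that by (meson UnCI converseI rtrancl.rtrancl_into_rtrancl)
    then have "b' l - b' k = w (k, l)" if "(k, l) \<in> R" for k l
      using b [OF that] that unfolding b'_def by auto
    moreover have "b' j - b' i = w (i, j)"
      using False unfolding b'_def by auto
    ultimately show ?thesis
      using e by blast
  qed
qed simp

lemma cycle_form_eq_step_weight:
  "cycle_form n C y S = (\<Sum>s\<leftarrow>S. step_weight (\<lambda>(i, j). \<Sum>k = 1..n. C k i j * int (y k)) s)"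
  unfolding cycle_form_def step_weight_def
  by (rule arg_cong [of _ _ sum_list], rule map_cong) auto

lemma nat_potential_exists:
  assumes "finite R" and "solves_lin_system n R C y"
  shows "\<exists>b :: nat \<Rightarrow> nat. \<forall>(i, j)\<in>R. int (b j) - int (b i) = (\<Sum>k = 1..n. C k i j * int (y k))"
proof -
  have "\<exists>b. \<forall>(i, j)\<in>R. b j - b i = (\<lambda>(i, j). \<Sum>k = 1..n. C k i j * int (y k)) (i, j)"
    using assms by (intro potential_exists)
      (auto simp: solves_lin_system_def cycle_form_eq_step_weight)
  then obtain b where b: "\<And>i j. (i, j) \<in> R \<Longrightarrow> b j - b i = (\<Sum>k = 1..n. C k i j * int (y k))"
    by auto
  \<comment> \<open>Subtracting the minimum keeps all differences and makes the potential usable as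
    a natural exponent.\<close>
  define m where "m = Min (b ` Field R)"
  have "m \<le> b i" if "i \<in> Field R" for i
    unfolding m_def using that assms(1) by (intro Min_le) (auto intro: finite_Field)
  then have "int (nat (b j - m)) - int (nat (b i - m)) = b j - b i" if "(i, j) \<in> R" for i j
    using that FieldI1 [OF that] FieldI2 [OF that] by simp
  then show ?thesis
    using b by (intro exI [of _ "\<lambda>i. nat (b i - m)"] ballI) (clarify, metis)
qed

section \<open>From linear to exponential systems\<close>

text \<open>The product of the powers of the \<open>y\<close> is
  \<open>2 ^ (d * (b j - b i))\<close>, read as a real power; it turns the exponent
  \<open>p * 2 ^ (d * b i)\<close> into \<open>p * 2 ^ (d * b j)\<close>.\<close>

lemma solves_exp_system_two_powers:
  assumes "\<forall>(i, j)\<in>R. int (b j) - int (b i) = (\<Sum>k = 1..n. C k i j * int (y k))"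
  shows "solves_exp_system n R C (\<lambda>i. 2 ^ (p * 2 ^ (d * b i))) (\<lambda>k. 2 ^ (y k * d))"
  unfolding solves_exp_system_def
proof clarify
  fix i j
  assume "(i, j) \<in> R"
  then have b: "int (b j) - int (b i) = (\<Sum>k = 1..n. C k i j * int (y k))"
    using assms by blast
  have "(\<Prod>k = 1..n. real (2 ^ (y k * d)) powi C k i j)
      = (\<Prod>k = 1..n. 2 powr (real_of_int (C k i j) * real (y k) * real d))"
  proof (rule prod.cong)
    fix k
    have "real (2 ^ (y k * d)) powi C k i j = real (2 ^ (y k * d)) powr real_of_int (C k i j)"
      by (rule powr_real_of_int' [symmetric]) simp_all
    also have "\<dots> = (2 powr real (y k * d)) powr real_of_int (C k i j)"
      by (simp only: powr_realpow of_nat_power of_nat_numeral zero_less_numeral)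
    finally have "real (2 ^ (y k * d)) powi C k i j
        = (2 powr real (y k * d)) powr real_of_int (C k i j)" .
    then show "real (2 ^ (y k * d)) powi C k i j
        = 2 powr (real_of_int (C k i j) * real (y k) * real d)"
      by (simp add: powr_powr algebra_simps)
  qed simp
  also have "\<dots> = 2 powr (\<Sum>k = 1..n. real_of_int (C k i j) * real (y k) * real d)"
    by (simp add: powr_sum)
  also have "(\<Sum>k = 1..n. real_of_int (C k i j) * real (y k) * real d)
      = real_of_int (\<Sum>k = 1..n. C k i j * int (y k)) * real d"
    by (simp add: sum_distrib_right)
  also have "\<dots> = (real (b j) - real (b i)) * real d"
    unfolding b [symmetric] by simp
  finally have prod: "(\<Prod>k = 1..n. real (2 ^ (y k * d)) powi C k i j)
      = 2 powr ((real (b j) - real (b i)) * real d)" .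
  have expo: "real (p * 2 ^ (d * b l)) = real p * 2 powr (real d * real (b l))" for l
    using powr_realpow [of 2 "d * b l"] by simp
  have "real (p * 2 ^ (d * b i)) * 2 powr ((real (b j) - real (b i)) * real d)
      = real p * 2 powr (real d * real (b i) + (real (b j) - real (b i)) * real d)"
    unfolding expo by (simp add: powr_add)
  also have "real d * real (b i) + (real (b j) - real (b i)) * real d = real d * real (b j)"
    by (simp add: algebra_simps)
  finally have "real (p * 2 ^ (d * b i)) * 2 powr ((real (b j) - real (b i)) * real d)
      = real (p * 2 ^ (d * b j))"
    by (simp only: expo)
  note scaling = this
  have pow: "real (2 ^ N) = 2 powr real N" for N
    by (simp add: powr_realpow)
  show "real (2 ^ (p * 2 ^ (d * b i))) powr
      (\<Prod>k = 1..n. real (2 ^ (y k * d)) powi C k i j) = real (2 ^ (p * 2 ^ (d * b j)))"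
    unfolding prod unfolding pow powr_powr scaling ..
qed

lemma exp_system_partition_regular_if_lin:
  assumes n: "n \<ge> 1" and R: "R \<subseteq> {1..n} \<times> {1..n}" and "lin_system_partition_regular n R C"
  shows "exp_system_partition_regular n R C"
  unfolding exp_system_partition_regular_def
proof (intro allI impI)
  fix c
  assume "finite_colouring c"
  then have fin: "finite (c ` {0<..})"
    by (simp add: finite_colouring_def)
  \<comment> \<open>All the numbers sought are powers of two, so it is their exponents that are
    coloured.\<close>
  define c' where "c' = (\<lambda>m. c (2 ^ m))"
  have range_c': "c' m \<in> c ` {0<..}" for m
    by (simp add: c'_def)
  then have "finite_colouring c'"
    unfolding finite_colouring_def by (intro finite_subset [OF _ fin]) auto
  then have "\<forall>N. \<exists>d>0. \<forall>m\<in>{1..N}. \<exists>p>0. \<forall>f\<le>N. c' (p * 2 ^ (d * f)) = c' (m * d)"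
    using monochromatic_multiples by blast
  then obtain D where Dpos: "\<And>N. D N > 0"
    and D: "\<And>N m. m \<in> {1..N} \<Longrightarrow> \<exists>p>0. \<forall>f\<le>N. c' (p * 2 ^ (D N * f)) = c' (m * D N)"
    by metis
  \<comment> \<open>\<open>D N\<close> depends on \<open>N\<close>, while \<open>N\<close> must
    bound a solution chosen for the colouring given by \<open>D N\<close>. The limit
    \<open>g\<close> breaks this circle.\<close>
  obtain g where g: "\<And>m. g m \<in> c ` {0<..}"
    and lim: "\<And>K. \<exists>N\<ge>K. \<forall>m\<le>K. c' (m * D N) = g m"
    by (rule limit_colouring [of "c ` {0<..}" "\<lambda>N m. c' (m * D N)", OF fin range_c']) blast
  have "finite_colouring g"
    unfolding finite_colouring_def using g by (intro finite_subset [OF _ fin]) auto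
  then obtain y col where y: "\<forall>k\<in>{1..n}. y k > 0 \<and> g (y k) = col"
    and sol: "solves_lin_system n R C y"
    using assms(3) unfolding lin_system_partition_regular_def by blast
  have "finite R"
    using R finite_subset by blast
  then obtain b where b: "\<forall>(i, j)\<in>R. int (b j) - int (b i) = (\<Sum>k = 1..n. C k i j * int (y k))"
    using nat_potential_exists sol by blast
  \<comment> \<open>\<open>K\<close> bounds the solution, so that \<open>g\<close> predicts its
    colours, and the potential, so that its values are admissible \<open>f\<close>.\<close>
  define K where "K = (\<Sum>k = 1..n. y k + b k)"
  have K: "y k + b k \<le> K" if "k \<in> {1..n}" for k
    unfolding K_def using that by (intro member_le_sum) auto
  obtain N where N: "N \<ge> K" "\<forall>m\<le>K. c' (m * D N) = g m"
    using lim by blast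
  have col: "c' (y k * D N) = col" if "k \<in> {1..n}" for k
    using N(2) K [OF that] y that by fastforce
  \<comment> \<open>Index \<open>1\<close> exists by \<open>n \<ge> 1\<close>; the multiple
    \<open>y 1 * D N\<close> passes the colour \<open>col\<close> on to the progression for
    \<open>x\<close>.\<close>
  have "y 1 \<in> {1..N}"
    using bspec [OF y, of 1] n N(1) K [of 1] by simp
  from D [OF this] obtain p where p: "p > 0" "\<forall>f\<le>N. c' (p * 2 ^ (D N * f)) = col"
    using col [of 1] n by auto
  have "c' (p * 2 ^ (D N * b i)) = col" if "i \<in> {1..n}" for i
    using p(2) K [OF that] N(1) by simp
  then show "\<exists>x y col. (\<forall>i\<in>{1..n}. x i > 0 \<and> x i \<noteq> 1 \<and> c (x i) = col \<and>
      y i > 0 \<and> y i \<noteq> 1 \<and> c (y i) = col) \<and> solves_exp_system n R C x y"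
    using solves_exp_system_two_powers [OF b, of p "D N"] col p(1) y Dpos [of N]
    by (intro exI [of _ "\<lambda>i. 2 ^ (p * 2 ^ (D N * b i))"] exI [of _ "\<lambda>k. 2 ^ (y k * D N)"]
      exI [of _ col]) (auto simp: c'_def)
qed

section \<open>From exponential to linear systems\<close>

abbreviation Omega :: "nat \<Rightarrow> nat" where
  "Omega m \<equiv> size (prime_factorization m)"

lemma Omega_prod_power:
  assumes "finite A" and "\<And>k. k \<in> A \<Longrightarrow> y k > 0"
  shows "Omega (\<Prod>k\<in>A. y k ^ e k) = (\<Sum>k\<in>A. e k * Omega (y k))"
  using assms
proof (induction A rule: finite_induct)
  case (insert a A)
  have "(\<Prod>k\<in>A. y k ^ e k) \<noteq> 0"
    using insert by simp
  moreover have "Omega (y a ^ m) = m * Omega (y a)" for m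
    using insert.prems by (induction m) (simp_all add: prime_factorization_mult)
  ultimately show ?case
    using insert by (simp add: prime_factorization_mult)
qed simp

lemma Omega_pos: "m > 0 \<Longrightarrow> m \<noteq> 1 \<Longrightarrow> Omega m > 0"
  by (simp add: prime_factorization_empty_iff size_eq_0_iff_empty flip: neq0_conv)

text \<open>Separating positive and negative coefficients turns the relation into an equality of two
  natural products, to which the complete additivity of \<open>Omega\<close> applies.\<close>

lemma Omega_linear_relation:
  fixes D :: "'a \<Rightarrow> int"
  assumes fin: "finite A" and pos: "\<And>k. k \<in> A \<Longrightarrow> y k > 0"
    and rel: "(\<Sum>k\<in>A. real_of_int (D k) * ln (real (y k))) = 0"
  shows "(\<Sum>k\<in>A. D k * int (Omega (y k))) = 0"
proof -
  have split: "real_of_int z = real (nat z) - real (nat (- z))" "z = int (nat z) - int (nat (- z))"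
    for z :: int
    by auto
  have ln_prod: "ln (real (\<Prod>k\<in>A. y k ^ e k)) = (\<Sum>k\<in>A. real (e k) * ln (real (y k)))" for e
    using pos fin by (simp add: ln_prod ln_realpow)
  have "(\<Sum>k\<in>A. real (nat (D k)) * ln (real (y k))) - (\<Sum>k\<in>A. real (nat (- D k)) * ln (real (y k))) = 0"
    using rel by (simp add: split(1) [of "D _"] left_diff_distrib sum_subtractf del: of_nat_nat)
  then have "ln (real (\<Prod>k\<in>A. y k ^ nat (D k))) = ln (real (\<Prod>k\<in>A. y k ^ nat (- D k)))"
    by (simp only: ln_prod)
  moreover have "(\<Prod>k\<in>A. y k ^ e k) > 0" for e
    using pos by (simp add: prod_pos)
  ultimately have "(\<Prod>k\<in>A. y k ^ nat (D k)) = (\<Prod>k\<in>A. y k ^ nat (- D k))"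
    by (metis ln_inj_iff of_nat_0_less_iff of_nat_eq_iff)
  then have "(\<Sum>k\<in>A. nat (D k) * Omega (y k)) = (\<Sum>k\<in>A. nat (- D k) * Omega (y k))"
    by (simp only: flip: Omega_prod_power [OF fin pos])
  then have "(\<Sum>k\<in>A. int (nat (D k)) * int (Omega (y k)))
      = (\<Sum>k\<in>A. int (nat (- D k)) * int (Omega (y k)))"
    by (metis (no_types, lifting) of_nat_mult of_nat_sum sum.cong)
  moreover have "(\<Sum>k\<in>A. D k * int (Omega (y k)))
      = (\<Sum>k\<in>A. int (nat (D k)) * int (Omega (y k)) - int (nat (- D k)) * int (Omega (y k)))"
    by (rule sum.cong) (use split(2) in \<open>metis left_diff_distrib\<close>)+
  ultimately show ?thesis
    by (simp only: sum_subtractf)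
qed

text \<open>Around a cycle, the list of ends is the list of starts rotated by one.\<close>

lemma oriented_cycle_telescope:
  fixes h :: "nat \<Rightarrow> real"
  assumes "oriented_cycle R S"
  shows "(\<Sum>s\<leftarrow>S. h (step_end s) - h (step_start s)) = 0"
proof -
  have "map (\<lambda>s. h (step_end s)) S = rotate1 (map (\<lambda>s. h (step_start s)) S)"
    using assms by (intro nth_equalityI) (auto simp: oriented_cycle_def nth_rotate1)
  moreover have "sum_list (rotate1 xs) = sum_list xs" for xs :: "real list"
    by (cases xs) auto
  ultimately show ?thesis
    by (simp add: sum_list_subtractf)
qed

definition cycle_coeff :: "(nat \<Rightarrow> nat \<Rightarrow> nat \<Rightarrow> int) \<Rightarrow> step list \<Rightarrow> nat \<Rightarrow> int" where
  "cycle_coeff C S k = (\<Sum>((i, j), d)\<leftarrow>S. (-1) ^ d * C k i j)"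

text \<open>The ring is general because \<open>a\<close> is a logarithm over the reals and an
  \<open>Omega\<close> value over the integers.\<close>

lemma sum_cycle_coeff:
  fixes a :: "nat \<Rightarrow> 'a :: comm_ring_1"
  shows "(\<Sum>((i, j), d)\<leftarrow>S. (-1) ^ d * (\<Sum>k = 1..n. of_int (C k i j) * a k))
    = (\<Sum>k = 1..n. of_int (cycle_coeff C S k) * a k)"
  unfolding cycle_coeff_def
  by (induction S) (auto simp: sum.distrib sum_distrib_left algebra_simps)

lemma solves_lin_system_Omega:
  assumes R: "R \<subseteq> {1..n} \<times> {1..n}" and sol: "solves_exp_system n R C x y"
    and x: "\<And>i. i \<in> {1..n} \<Longrightarrow> x i > 1" and y: "\<And>i. i \<in> {1..n} \<Longrightarrow> y i > 0"
  shows "solves_lin_system n R C (\<lambda>k. Omega (y k))"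
  unfolding solves_lin_system_def
proof (intro allI impI)
  fix S
  assume S: "oriented_cycle R S"
  \<comment> \<open>Two logarithms turn \<open>x i powr w = x j\<close> into
    \<open>h j = h i + ln w\<close>; the outer one requires \<open>x i > 1\<close>.\<close>
  define h where "h = (\<lambda>i. ln (ln (real (x i))))"
  have edge: "(\<Sum>k = 1..n. real_of_int (C k i j) * ln (real (y k))) = h j - h i" if "(i, j) \<in> R" for i j
  proof -
    define w where "w = (\<Prod>k = 1..n. real (y k) powi C k i j)"
    have "w > 0"
      unfolding w_def using y by (intro prod_pos) (simp add: zero_less_power_int)
    have "ln (real (x i)) > 0"
      using that R x by fastforce
    have "real (x i) powr w = real (x j)"
      using sol that unfolding solves_exp_system_def w_def by blast
    then have "ln (real (x j)) = w * ln (real (x i))"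
      by (metis ln_powr)
    then have "h j = ln w + h i"
      unfolding h_def using \<open>w > 0\<close> \<open>ln (real (x i)) > 0\<close> by (simp add: ln_mult)
    moreover have "ln w = (\<Sum>k = 1..n. real_of_int (C k i j) * ln (real (y k)))"
    proof -
      have ln_powi: "ln (real (y k) powi C k i j) = real_of_int (C k i j) * ln (real (y k))"
        if "k \<in> {1..n}" for k
        using y [OF that] ln_powr by (subst powr_real_of_int' [symmetric]) auto
      have "ln w = (\<Sum>k = 1..n. ln (real (y k) powi C k i j))"
        unfolding w_def using y by (intro ln_prod) (simp_all add: power_int_eq_0_iff)
      also have "\<dots> = (\<Sum>k = 1..n. real_of_int (C k i j) * ln (real (y k)))"
        using ln_powi by (rule sum.cong [OF refl])
      finally show ?thesis .
    qed
    ultimately show ?thesis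
      by simp
  qed
  have "(\<Sum>((i, j), d)\<leftarrow>S. (-1) ^ d * (\<Sum>k = 1..n. real_of_int (C k i j) * ln (real (y k))))
      = (\<Sum>s\<leftarrow>S. h (step_end s) - h (step_start s))"
  proof (rule arg_cong [of _ _ sum_list], rule map_cong)
    fix s
    assume "s \<in> set S"
    moreover obtain i j d where s: "s = ((i, j), d)"
      by (metis prod.exhaust)
    ultimately have "(i, j) \<in> R" "d \<in> {0, 1}"
      using S unfolding oriented_cycle_def by blast+
    then show "(case s of (x, d) \<Rightarrow> (case x of (i, j) \<Rightarrow> \<lambda>d. (-1) ^ d *
        (\<Sum>k = 1..n. real_of_int (C k i j) * ln (real (y k)))) d) = h (step_end s) - h (step_start s)"
      using edge unfolding s by (auto simp: step_start_def step_end_def)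
  qed simp
  then have "(\<Sum>k = 1..n. real_of_int (cycle_coeff C S k) * ln (real (y k))) = 0"
    unfolding sum_cycle_coeff using oriented_cycle_telescope [OF S] by simp
  then have "(\<Sum>k = 1..n. cycle_coeff C S k * int (Omega (y k))) = 0"
    using y by (intro Omega_linear_relation) auto
  then show "cycle_form n C (\<lambda>k. Omega (y k)) S = 0"
    using sum_cycle_coeff [where a = "\<lambda>k. int (Omega (y k))"] unfolding cycle_form_def
    by simp
qed

lemma lin_system_partition_regular_if_exp:
  assumes R: "R \<subseteq> {1..n} \<times> {1..n}" and "exp_system_partition_regular n R C"
  shows "lin_system_partition_regular n R C"
  unfolding lin_system_partition_regular_def
proof (intro allI impI)
  fix c
  assume c: "finite_colouring c"
  have "finite_colouring (\<lambda>m. c (Omega m))"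
    unfolding finite_colouring_def
  proof (rule finite_subset)
    \<comment> \<open>\<open>Omega 1 = 0\<close> is not among the positive integers on which
      \<open>c\<close> has finite range, so \<open>c 0\<close> is added.\<close>
    show "finite (insert (c 0) (c ` {0<..}))"
      using c by (simp add: finite_colouring_def)
    have "c k \<in> insert (c 0) (c ` {0<..})" for k
      by (cases "k = 0") auto
    then show "(\<lambda>m. c (Omega m)) ` {0<..} \<subseteq> insert (c 0) (c ` {0<..})"
      by blast
  qed
  then obtain x y col where xy: "\<forall>i\<in>{1..n}. x i > 0 \<and> x i \<noteq> 1 \<and> c (Omega (x i)) = col \<and>
      y i > 0 \<and> y i \<noteq> 1 \<and> c (Omega (y i)) = col" and sol: "solves_exp_system n R C x y"
    using assms(2) unfolding exp_system_partition_regular_def by blast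
  have "solves_lin_system n R C (\<lambda>k. Omega (y k))"
    by (rule solves_lin_system_Omega [OF R sol]) (metis xy less_one nat_neq_iff not_less0)+
  \<comment> \<open>Positivity of the new solution comes from \<open>y k \<noteq> 1\<close>.\<close>
  moreover have "\<forall>k\<in>{1..n}. Omega (y k) > 0 \<and> c (Omega (y k)) = col"
    using xy Omega_pos by simp
  ultimately show "\<exists>y col. (\<forall>k\<in>{1..n}. y k > 0 \<and> c (y k) = col) \<and> solves_lin_system n R C y"
    by (intro exI [of _ "\<lambda>k. Omega (y k)"] exI [of _ col] conjI)
qed

theorem theorem1:
  fixes n :: nat and R :: "(nat \<times> nat) set" and C :: "nat \<Rightarrow> nat \<Rightarrow> nat \<Rightarrow> int"
  assumes "n \<ge> 1" and "R \<subseteq> {1..n} \<times> {1..n}"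
  shows "exp_system_partition_regular n R C \<longleftrightarrow> lin_system_partition_regular n R C"
  using assms exp_system_partition_regular_if_lin lin_system_partition_regular_if_exp by blast

end
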